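(* Let $n_m,p\ge 1$, $n_o>p$, let $\mathbf{X}_o\in\mathbb{R}^{n_o\times p}$ with $\mathbf{X}_o^T\mathbf{X}_o$ invertible, $\mathbf{X}_m\in\mathbb{R}^{n_m\times p}$ with rows $\mathbf{x}_1,\dots,\mathbf{x}_{n_m}$, and $\mathbf{Y}_o\in\mathbb{R}^{n_o}$. Consider the augmented regression of $\begin{pmatrix}\mathbf{Y}_o\\ \mathbf{0}_{n_m}\end{pmatrix}$ on $$\mathbf{Z}=\begin{pmatrix}\mathbf{X}_o&\mathbf{0}_{n_o\times n_m}\\ \mathbf{X}_m&-\mathbf{I}_{n_m}\end{pmatrix},$$ and let $\mathbf{b}_m\in\mathbb{R}^{n_m}$ be the ordinary least squares coefficients of the last $n_m$ columns (the imputations of the missing responses). Then for each $k=1,\dots,n_m$ the ordinary least squares standard error of the $k$-th entry of $\mathbf{b}_m$ in the augmented regression equals the conventional standard deviation used to construct a prediction interval, from the regression of $\mathbf{Y}_o$ on $\mathbf{X}_o$, for a new observation with covariate row $\mathbf{x}_k$: $$s_{b_{m},k}=\sqrt{\hat\sigma_\varepsilon^2\left(1+\mathbf{x}_k(\mathbf{X}_o^T\mathbf{X}_o)^{-1}\mathbf{x}_k^T\right)},\qquad \hat\sigma_\varepsilon^2=\frac{\|\mathbf{Y}_o-\mathbf{X}_o\mathbf{b}_o\|^2}{n_o-p},\quad \mathbf{b}_o=(\mathbf{X}_o^T\mathbf{X}_o)^{-1}\mathbf{X}_o^T\mathbf{Y}_o .$$ This common value is the standard error attached to the EM algorithm imputation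 of the $k$-th missing response.
   Context: A response variable has $n=n_o+n_m$ entries, of which $n_o$ are observed (vector $\mathbf{Y}_o$) and $n_m$ are missing and replaced by zeros; $\mathbf{X}_o$ and $\mathbf{X}_m$ are the (fully known) covariate matrices, possibly including an intercept column of ones, for the observations with observed and missing response, respectively. For a least squares regression of $\mathbf{W}\in\mathbb{R}^{N}$ on a full-column-rank $\mathbf{Z}\in\mathbb{R}^{N\times q}$ with $N>q$ and coefficients $\mathbf{b}=(\mathbf{Z}^T\mathbf{Z})^{-1}\mathbf{Z}^T\mathbf{W}$, the ordinary least squares standard error of the $j$-th coefficient is $\sqrt{\hat\sigma^2[(\mathbf{Z}^T\mathbf{Z})^{-1}]_{jj}}$ with $\hat\sigma^2=\|\mathbf{W}-\mathbf{Z}\mathbf{b}\|^2/(N-q)$. For the augmented regression, $N=n_o+n_m$ and $q=p+n_m$. The final sentence of the claim is terminological: it names this quantity as the imputation standard error. *)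

theory Defs
  imports "HOL-Analysis.Analysis"
begin

definition ols_coef :: "real^'q^'n \<Rightarrow> real^'n \<Rightarrow> real^'q" where
  "ols_coef Z W = matrix_inv (transpose Z ** Z) *v (transpose Z *v W)"

definition ols_residual_variance :: "real^'q^'n \<Rightarrow> real^'n \<Rightarrow> real" where
  "ols_residual_variance Z W =
     (norm (W - Z *v ols_coef Z W))\<^sup>2 / (real CARD('n) - real CARD('q))"

definition ols_se :: "real^'q^'n \<Rightarrow> real^'n \<Rightarrow> 'q \<Rightarrow> real" where
  "ols_se Z W j =
     sqrt (ols_residual_variance Z W * matrix_inv (transpose Z ** Z) $ j $ j)"

definition prediction_sd :: "real^'p^'n \<Rightarrow> real^'n \<Rightarrow> real^'p \<Rightarrow> real" where
  "prediction_sd X Y x =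
     sqrt (ols_residual_variance X Y *
           (1 + x \<bullet> (matrix_inv (transpose X ** X) *v x)))"

(* Block vectors and matrices are indexed by sum types: Inl is the first block and Inr the
   second.  So the coefficients of the last block of columns of augmented_design, i.e. the
   imputed values, are the entries of ols_coef at the indices Inr k. *)

definition augmented_response :: "real^'o \<Rightarrow> real^('o + 'm::finite)" where
  "augmented_response Yo = (\<chi> i. case i of Inl r \<Rightarrow> Yo $ r | Inr k \<Rightarrow> 0)"

definition augmented_design :: "real^'p^'o \<Rightarrow> real^'p^'m::finite \<Rightarrow> real^('p + 'm)^('o + 'm)" where
  "augmented_design Xo Xm = (\<chi> i j.
     case (i, j) of
       (Inl r, Inl c) \<Rightarrow> Xo $ r $ c
     | (Inl r, Inr l) \<Rightarrow> 0
     | (Inr k, Inl c) \<Rightarrow> Xm $ k $ c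
     | (Inr k, Inr l) \<Rightarrow> - (mat 1 :: real^'m^'m) $ k $ l)"

definition imputation_se :: "real^'p^'o \<Rightarrow> real^'p^'m \<Rightarrow> real^'o \<Rightarrow> 'm \<Rightarrow> real" where
  "imputation_se Xo Xm Yo k =
     ols_se (augmented_design Xo Xm) (augmented_response Yo) (Inr k)"

(* The augmented design has full column rank, so the matrix_inv in its regression is a
   genuine inverse. *)

lemma invertible_augmented_gram:
  fixes Xo :: "real^'p^'o" and Xm :: "real^'p^'m"
  assumes "invertible (transpose Xo ** Xo)"
  shows "invertible (transpose (augmented_design Xo Xm) ** augmented_design Xo Xm)"
proof -
  let ?Z = "augmented_design Xo Xm"
  have split: "(\<Sum>i\<in>UNIV. f i) = (\<Sum>c\<in>UNIV. f (Inl c)) + (\<Sum>l\<in>UNIV. f (Inr l))"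
    for f :: "'p + 'm \<Rightarrow> real"
    using sum.Plus[of "UNIV :: 'p set" "UNIV :: 'm set" f] by (simp add: comp_def)
  have top: "(?Z *v v) $ Inl r = (Xo *v (\<chi> c. v $ Inl c)) $ r" for v r
    by (simp add: augmented_design_def matrix_vector_mult_def split)
  have bot: "(?Z *v v) $ Inr k = (Xm *v (\<chi> c. v $ Inl c)) $ k - v $ Inr k" for v k
  proof -
    have "(\<Sum>l\<in>UNIV. (mat 1 :: real^'m^'m) $ k $ l * v $ Inr l) = v $ Inr k"
      by (simp add: mat_def if_distrib if_distribR cong: if_cong)
    then show ?thesis
      by (simp add: augmented_design_def matrix_vector_mult_def split sum_negf)
  qed
  have "v = 0" if v: "(transpose ?Z ** ?Z) *v v = 0" for v
  proof -
    have "(?Z *v v) \<bullet> (?Z *v v) = v \<bullet> ((transpose ?Z ** ?Z) *v v)"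
      by (simp add: dot_lmul_matrix[symmetric] matrix_vector_mul_assoc[symmetric]
          inner_commute)
    then have Zv: "?Z *v v = 0" using v by simp
    define u where "u = (\<chi> c. v $ Inl c)"
    have "Xo *v u = 0" using top[of v] Zv by (simp add: vec_eq_iff u_def)
    then have "(transpose Xo ** Xo) *v u = 0"
      by (simp add: matrix_vector_mul_assoc[symmetric])
    then have u: "u = 0" 
      using assms unfolding invertible_left_inverse matrix_left_invertible_ker by blast
    then have "v $ Inr k = 0" for k
      using bot[of v k] Zv by (simp add: u_def[symmetric])
    moreover have "v $ Inl c = 0" for c
      using u by (simp add: u_def vec_eq_iff)
    ultimately show "v = 0"
      unfolding vec_eq_iff zero_index split_sum_all by blast
  qed
  then show ?thesis
    unfolding invertible_left_inverse matrix_left_invertible_ker by blast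
qed

end

theory Submission imports Defs begin

text \<open>
  Both quantities can be read off from explicit solutions of the augmented normal equations.  With
  \<open>b\<close> the coefficients of the regression on the observed data, the augmented coefficients are
  \<open>(b, Xm b)\<close>, so the residual is \<open>(Yo - Xo b, 0)\<close>; the residual sum of squares and
  the degrees of freedom are therefore unchanged.  With \<open>x\<close> the \<open>k\<close>-th row of \<open>Xm\<close> and
  \<open>u\<close> the solution of \<open>Xo\<^sup>T Xo u = x\<close>, the column of the inverse augmented Gram matrix
  belonging to the \<open>k\<close>-th imputation is \<open>(u, Xm u + e)\<close> with \<open>e\<close> the \<open>k\<close>-th unit vector,
  whose relevant entry is \<open>1 + x \<bullet> u\<close>.
\<close>

definition block_vec :: "real^'a \<Rightarrow> real^'b \<Rightarrow> real^('a + 'b)" where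
  "block_vec a b = (\<chi> i. case i of Inl r \<Rightarrow> a $ r | Inr k \<Rightarrow> b $ k)"

lemma block_vec_nth [simp]:
  "block_vec a b $ Inl r = a $ r"
  "block_vec a b $ Inr k = b $ k"
  by (simp_all add: block_vec_def)

lemma block_vec_eqI:
  fixes v w :: "real^('a::finite + 'b::finite)"
  assumes "\<And>r. v $ Inl r = w $ Inl r" "\<And>k. v $ Inr k = w $ Inr k"
  shows "v = w"
  unfolding vec_eq_iff split_sum_all using assms by blast

lemma sum_UNIV_Plus:
  fixes f :: "'a::finite + 'b::finite \<Rightarrow> 'c::comm_monoid_add"
  shows "(\<Sum>i\<in>UNIV. f i) = (\<Sum>a\<in>UNIV. f (Inl a)) + (\<Sum>b\<in>UNIV. f (Inr b))"
  using sum.Plus[of "UNIV :: 'a set" "UNIV :: 'b set" f] by (simp add: comp_def)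

lemma norm_block_vec_0: "norm (block_vec a 0) = norm a"
  by (simp add: norm_eq_sqrt_inner inner_vec_def sum_UNIV_Plus)

lemma block_vec_diff: "block_vec a b - block_vec c d = block_vec (a - c) (b - d)"
  by (rule block_vec_eqI) simp_all

lemma augmented_response_eq: "augmented_response Y = block_vec Y 0"
  by (rule block_vec_eqI) (simp_all add: augmented_response_def)

lemma augmented_design_mult:
  fixes Xo :: "real^'p^'o" and Xm :: "real^'p^'m"
  shows "augmented_design Xo Xm *v block_vec u w = block_vec (Xo *v u) (Xm *v u - w)"
proof (rule block_vec_eqI)
  fix k
  have "(\<Sum>l\<in>UNIV. (mat 1 :: real^'m^'m) $ k $ l * w $ l) = w $ k"
    by (simp add: mat_def if_distrib if_distribR cong: if_cong)
  then show "(augmented_design Xo Xm *v block_vec u w) $ Inr k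
      = block_vec (Xo *v u) (Xm *v u - w) $ Inr k"
    by (simp add: augmented_design_def matrix_vector_mult_def sum_UNIV_Plus sum_negf)
qed (simp add: augmented_design_def matrix_vector_mult_def sum_UNIV_Plus)

lemma transpose_augmented_design_mult:
  fixes Xo :: "real^'p^'o" and Xm :: "real^'p^'m"
  shows "transpose (augmented_design Xo Xm) *v block_vec a b
     = block_vec (transpose Xo *v a + transpose Xm *v b) (- b)"
proof (rule block_vec_eqI)
  fix k
  have "(\<Sum>l\<in>UNIV. (mat 1 :: real^'m^'m) $ l $ k * b $ l) = b $ k"
    by (simp add: mat_def if_distrib if_distribR cong: if_cong)
  then show "(transpose (augmented_design Xo Xm) *v block_vec a b) $ Inr k
      = block_vec (transpose Xo *v a + transpose Xm *v b) (- b) $ Inr k"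
    by (simp add: augmented_design_def transpose_def matrix_vector_mult_def sum_UNIV_Plus sum_negf)
qed (simp add: augmented_design_def transpose_def matrix_vector_mult_def sum_UNIV_Plus)

lemma matrix_inv_cancel:
  fixes A :: "real^'n^'n"
  assumes "invertible A"
  shows "A *v (matrix_inv A *v x) = x" "matrix_inv A *v (A *v x) = x"
proof -
  have "A ** matrix_inv A = mat 1 \<and> matrix_inv A ** A = mat 1"
    using someI_ex[OF assms[unfolded invertible_def]] by (simp add: matrix_inv_def)
  then show "A *v (matrix_inv A *v x) = x" "matrix_inv A *v (A *v x) = x"
    by (simp_all add: matrix_vector_mul_assoc)
qed

text \<open>Imputing \<open>Xm *v b\<close> makes the second block of fitted values zero, so the
  augmented normal equations reduce to those for \<open>Xo\<close>; invertibility of the augmented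
  Gram matrix gives uniqueness.\<close>

lemma ols_coef_augmented:
  fixes Xo :: "real^'p^'o" and Xm :: "real^'p^'m"
  assumes "invertible (transpose Xo ** Xo)"
  shows "ols_coef (augmented_design Xo Xm) (augmented_response Yo)
    = block_vec (ols_coef Xo Yo) (Xm *v ols_coef Xo Yo)"
proof -
  let ?Z = "augmented_design Xo Xm" and ?b = "ols_coef Xo Yo"
  have "transpose Xo *v (Xo *v ?b) = transpose Xo *v Yo"
    using matrix_inv_cancel(1)[OF assms] by (simp add: ols_coef_def matrix_vector_mul_assoc matrix_mul_assoc)
  then have "(transpose ?Z ** ?Z) *v block_vec ?b (Xm *v ?b)
      = transpose ?Z *v augmented_response Yo"
    \<comment> \<open>The deleted simp rule would turn \<open>transpose A *v x\<close> into
      \<open>x v* A\<close> and block the blockwise product lemma.\<close>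
    by (simp add: augmented_response_eq matrix_vector_mul_assoc[symmetric]
        augmented_design_mult transpose_augmented_design_mult del: transpose_matrix_vector)
  then show ?thesis
    using matrix_inv_cancel(2)[OF invertible_augmented_gram[OF assms]]
    by (metis ols_coef_def)
qed

text \<open>The number of missing responses is added to both rows and columns and cancels in the
  degrees of freedom.\<close>

lemma ols_residual_variance_augmented:
  fixes Xo :: "real^'p^'o" and Xm :: "real^'p^'m"
  assumes "invertible (transpose Xo ** Xo)"
  shows "ols_residual_variance (augmented_design Xo Xm) (augmented_response Yo)
    = ols_residual_variance Xo Yo"
  unfolding ols_residual_variance_def ols_coef_augmented[OF assms]
  by (simp add: augmented_response_eq augmented_design_mult block_vec_diff norm_block_vec_0)

lemma matrix_inv_augmented_gram_nth:
  fixes Xo :: "real^'p^'o" and Xm :: "real^'p^'m"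
  assumes "invertible (transpose Xo ** Xo)"
  shows "matrix_inv (transpose (augmented_design Xo Xm) ** augmented_design Xo Xm) $ Inr k $ Inr k
    = 1 + Xm $ k \<bullet> (matrix_inv (transpose Xo ** Xo) *v Xm $ k)"
proof -
  let ?Z = "augmented_design Xo Xm"
  define u where "u = matrix_inv (transpose Xo ** Xo) *v Xm $ k"
  \<comment> \<open>The second block is chosen so that \<open>?Z *v v\<close> is
    \<open>(Xo *v u, - axis k 1)\<close>; multiplying by \<open>transpose ?Z\<close> then gives
    \<open>Xm $ k - Xm $ k = 0\<close> on top and \<open>axis k 1\<close> below.\<close>
  define v where "v = block_vec u (Xm *v u + axis k 1)"
  have u: "transpose Xo *v (Xo *v u) = Xm $ k"
    using matrix_inv_cancel(1)[OF assms] by (simp add: u_def matrix_vector_mul_assoc matrix_mul_assoc)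
  have "transpose Xm *v (- axis k 1) = - (Xm $ k)"
    by (simp add: vec.neg matrix_vector_mult_basis column_transpose row_def)
  then have "(transpose ?Z ** ?Z) *v v = block_vec 0 (axis k 1)"
    by (simp add: v_def matrix_vector_mul_assoc[symmetric] augmented_design_mult
        transpose_augmented_design_mult u del: transpose_matrix_vector)
  also have "\<dots> = axis (Inr k) 1"
    by (rule block_vec_eqI) (simp_all add: axis_def)
  finally have "matrix_inv (transpose ?Z ** ?Z) *v axis (Inr k) 1 = v"
    using matrix_inv_cancel(2)[OF invertible_augmented_gram[OF assms]] by metis
  then have "matrix_inv (transpose ?Z ** ?Z) $ Inr k $ Inr k = v $ Inr k"
    by (simp add: matrix_vector_mult_basis column_def vec_eq_iff)
  also have "\<dots> = 1 + Xm $ k \<bullet> u"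
    by (simp add: v_def matrix_vector_mul_component)
  finally show ?thesis by (simp add: u_def)
qed

theorem theorem5:
  fixes Xo :: "real^'p^'o" and Xm :: "real^'p^'m" and Yo :: "real^'o" and k :: 'm
  assumes "CARD('p) < CARD('o)"
    and "invertible (transpose Xo ** Xo)"
  shows "ols_se (augmented_design Xo Xm) (augmented_response Yo) (Inr k)
           = prediction_sd Xo Yo (Xm $ k)
         \<and> imputation_se Xo Xm Yo k = prediction_sd Xo Yo (Xm $ k)"
  \<comment> \<open>The two factors under the square root agree separately.\<close>
  unfolding imputation_se_def ols_se_def prediction_sd_def
    ols_residual_variance_augmented[OF assms(2)] matrix_inv_augmented_gram_nth[OF assms(2)]
  by simp

end
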